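(* Let $G$ be a semitopological semigroup and let $\mathcal{A}$ be a closed left m-introverted subalgebra of $\mathcal{CB}(G)$. Then $\Phi_{\mathcal{A}}\cup\{0\}$ is a semigroup under the left Arens product. If $\mathcal{A}$ is unital (contains the constant function $1$), then $\Phi_{\mathcal{A}}$ itself is a semigroup.
   Context: A semitopological semigroup is a semigroup with a (Hausdorff) topology for which multiplication is separately continuous; $G$ need not be locally compact. $\mathcal{CB}(G)$ is the algebra of continuous bounded complex functions on $G$ with uniform norm. For $f\in\mathcal{CB}(G)$, $s\in G$: $f\cdot s(t)=f(st)$. $\Phi_{\mathcal{A}}$ is the set of non-zero characters (multiplicative linear functionals) of $\mathcal{A}$. A closed subalgebra $\mathcal{A}\subset\mathcal{CB}(G)$ (not assumed self-adjoint or unital) is left m-introverted if it is invariant under left translations $f\mapsto f\cdot s$ and, for each $\chi\in\Phi_{\mathcal{A}}$ and $f\in\mathcal{A}$, the function $\chi\cdot f(s)=\chi(f\cdot s)$ belongs to $\mathcal{A}$. The left Arens product is $\chi\square\chi'(f)=\chi(\chi'\cdot f)$ for $f\in\mathcal{A}$ (with $0\cdot f=0$). *)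

theory Defs
  imports "HOL-Analysis.Analysis"
begin

text \<open>Multiplication is only separately continuous, in contrast to
  \<^class>\<open>topological_semigroup_mult\<close>.\<close>

class semitopological_semigroup = semigroup_mult + t2_space +
  assumes open_vimage_mult_left: "open U \<Longrightarrow> open ((\<lambda>t. s * t) -` U)"
    and open_vimage_mult_right: "open U \<Longrightarrow> open ((\<lambda>t. t * s) -` U)"

lemma separately_continuous:
  fixes s :: "'g::semitopological_semigroup"
  shows "continuous_on UNIV (\<lambda>t. s * t)" and "continuous_on UNIV (\<lambda>t. t * s)"
  by (simp_all add: continuous_on_open_vimage open_vimage_mult_left open_vimage_mult_right)

text \<open>The library provides the vector space operations over the reals and the uniform norm on
  \<open>'g \<Rightarrow>\<^sub>C complex\<close>; the remaining operations of the complex algebra of continuous bounded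
  functions are added here.\<close>

unbundle bcontfun.lifting

lift_definition mult_bcontfun ::
    "('g::topological_space \<Rightarrow>\<^sub>C complex) \<Rightarrow> ('g \<Rightarrow>\<^sub>C complex) \<Rightarrow> ('g \<Rightarrow>\<^sub>C complex)"
  is "\<lambda>f g t. f t * g t"
proof -
  fix f g :: "'g \<Rightarrow> complex"
  assume f: "f \<in> bcontfun" and g: "g \<in> bcontfun"
  obtain a where a: "\<And>t. norm (f t) \<le> a"
    using f by (auto simp: bcontfun_def bounded_iff)
  obtain b where b: "\<And>t. norm (g t) \<le> b"
    using g by (auto simp: bcontfun_def bounded_iff)
  have "norm (f t * g t) \<le> a * b" for t
    unfolding norm_mult
    by (intro mult_mono a b order_trans[OF norm_ge_zero a]) simp
  then show "(\<lambda>t. f t * g t) \<in> bcontfun"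
    using f g by (auto simp: bcontfun_def bounded_iff intro!: continuous_intros)
qed

definition scaleC_bcontfun ::
    "complex \<Rightarrow> ('g::topological_space \<Rightarrow>\<^sub>C complex) \<Rightarrow> ('g \<Rightarrow>\<^sub>C complex)"
  where "scaleC_bcontfun c f = mult_bcontfun (const_bcontfun c) f"

lift_definition left_translate ::
    "('g::semitopological_semigroup \<Rightarrow>\<^sub>C complex) \<Rightarrow> 'g \<Rightarrow> ('g \<Rightarrow>\<^sub>C complex)"
  is "\<lambda>f s t. f (s * t)"
proof -
  fix f :: "'g \<Rightarrow> complex" and s :: 'g
  assume f: "f \<in> bcontfun"
  have "continuous_on UNIV (\<lambda>t. f (s * t))"
    using f by (intro continuous_on_compose2[OF _ separately_continuous(1)]) (auto simp: bcontfun_def)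
  moreover have "bounded (range (\<lambda>t. f (s * t)))"
    using f by (auto simp: bcontfun_def intro: bounded_subset)
  ultimately show "(\<lambda>t. f (s * t)) \<in> bcontfun"
    by (simp add: bcontfun_def)
qed

definition closed_subalgebra :: "('g::topological_space \<Rightarrow>\<^sub>C complex) set \<Rightarrow> bool"
  where "closed_subalgebra A \<longleftrightarrow>
    closed A \<and> 0 \<in> A \<and>
    (\<forall>f\<in>A. \<forall>g\<in>A. f + g \<in> A) \<and>
    (\<forall>c. \<forall>f\<in>A. scaleC_bcontfun c f \<in> A) \<and>
    (\<forall>f\<in>A. \<forall>g\<in>A. mult_bcontfun f g \<in> A)"

text \<open>A functional on \<open>A\<close> is represented by its extensional extension (\<open>undefined\<close> outside \<open>A\<close>),
  so that equality of representatives is equality as functions on \<open>A\<close>.\<close>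

definition zero_functional ::
    "('g::topological_space \<Rightarrow>\<^sub>C complex) set \<Rightarrow> ('g \<Rightarrow>\<^sub>C complex) \<Rightarrow> complex"
  where "zero_functional A = (\<lambda>f\<in>A. 0)"

definition characters ::
    "('g::topological_space \<Rightarrow>\<^sub>C complex) set \<Rightarrow> (('g \<Rightarrow>\<^sub>C complex) \<Rightarrow> complex) set"
  where "characters A = {\<phi> \<in> extensional A.
    (\<forall>f\<in>A. \<forall>g\<in>A. \<phi> (f + g) = \<phi> f + \<phi> g) \<and>
    (\<forall>c. \<forall>f\<in>A. \<phi> (scaleC_bcontfun c f) = c * \<phi> f) \<and>
    (\<forall>f\<in>A. \<forall>g\<in>A. \<phi> (mult_bcontfun f g) = \<phi> f * \<phi> g) \<and>
    \<phi> \<noteq> zero_functional A}"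

definition left_m_introverted :: "('g::semitopological_semigroup \<Rightarrow>\<^sub>C complex) set \<Rightarrow> bool"
  where "left_m_introverted A \<longleftrightarrow>
    (\<forall>f\<in>A. \<forall>s. left_translate f s \<in> A) \<and>
    (\<forall>\<phi>\<in>characters A. \<forall>f\<in>A. (\<lambda>s. \<phi> (left_translate f s)) \<in> apply_bcontfun ` A)"

text \<open>\<open>Bcontfun\<close> is meaningful only on continuous bounded functions; for \<open>f \<in> A\<close> and \<open>\<phi>\<close> a
  character or zero, this is guaranteed when \<open>A\<close> is left m-introverted
  (lemmas \<open>functional_act_character\<close> and \<open>functional_act_zero\<close> below).\<close>

definition functional_act ::
    "(('g::semitopological_semigroup \<Rightarrow>\<^sub>C complex) \<Rightarrow> complex) \<Rightarrow>
      ('g \<Rightarrow>\<^sub>C complex) \<Rightarrow> ('g \<Rightarrow>\<^sub>C complex)"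
  where "functional_act \<phi> f = Bcontfun (\<lambda>s. \<phi> (left_translate f s))"

lemma functional_act_character:
  assumes "left_m_introverted A" "\<phi> \<in> characters A" "f \<in> A"
  shows "functional_act \<phi> f \<in> A"
    and "apply_bcontfun (functional_act \<phi> f) s = \<phi> (left_translate f s)"
proof -
  obtain g where g: "g \<in> A" "(\<lambda>s. \<phi> (left_translate f s)) = apply_bcontfun g"
    using assms unfolding left_m_introverted_def by blast
  then have "functional_act \<phi> f = g"
    by (simp add: functional_act_def apply_bcontfun_inverse)
  with g show "functional_act \<phi> f \<in> A"
    and "apply_bcontfun (functional_act \<phi> f) s = \<phi> (left_translate f s)"
    by (simp_all add: fun_eq_iff)
qed

lemma functional_act_zero:
  assumes "left_m_introverted A" "f \<in> A"
  shows "functional_act (zero_functional A) f = 0"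
  using assms
  by (simp add: functional_act_def zero_functional_def left_m_introverted_def
      zero_bcontfun_def)

definition left_arens ::
    "('g::semitopological_semigroup \<Rightarrow>\<^sub>C complex) set \<Rightarrow>
      (('g \<Rightarrow>\<^sub>C complex) \<Rightarrow> complex) \<Rightarrow> (('g \<Rightarrow>\<^sub>C complex) \<Rightarrow> complex) \<Rightarrow>
      (('g \<Rightarrow>\<^sub>C complex) \<Rightarrow> complex)"
  where "left_arens A \<phi> \<phi>' = (\<lambda>f\<in>A. \<phi> (functional_act \<phi>' f))"

text \<open>The library locale \<^locale>\<open>semigroup\<close> concerns operations on a whole type. As there,
  semigroups are nonempty.\<close>

definition semigroup_on :: "'a set \<Rightarrow> ('a \<Rightarrow> 'a \<Rightarrow> 'a) \<Rightarrow> bool"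
  where "semigroup_on S m \<longleftrightarrow>
    S \<noteq> {} \<and>
    (\<forall>x\<in>S. \<forall>y\<in>S. m x y \<in> S) \<and>
    (\<forall>x\<in>S. \<forall>y\<in>S. \<forall>z\<in>S. m (m x y) z = m x (m y z))"

end

theory Submission
  imports Defs
begin

text \<open>Left translations are algebra endomorphisms of \<open>A\<close>, so for a multiplicative
  linear functional \<open>y\<close>, zero included, the map f -> y.f is again an algebra
  endomorphism of \<open>A\<close> (\<open>functional_act_hom\<close>), and it commutes with left
  translations. The Arens product x y is \<open>x\<close> composed with this endomorphism, hence
  multiplicative and linear. Commutation with translations gives (x y).f = x.(y.f)
  (\<open>functional_act_left_arens\<close>), so associativity becomes associativity of composition.
  In the unital case the nonzero functionals are those with value 1 at the constant 1; that constant
  is fixed by every character's action, so the product of two characters cannot vanish.\<close>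

lemma apply_mult_bcontfun [simp]:
  "apply_bcontfun (mult_bcontfun f g) t = apply_bcontfun f t * apply_bcontfun g t"
  by transfer simp

lemma apply_scaleC_bcontfun [simp]:
  "apply_bcontfun (scaleC_bcontfun c f) t = c * apply_bcontfun f t"
  by (simp add: scaleC_bcontfun_def const_bcontfun.rep_eq)

lemma apply_left_translate [simp]:
  "apply_bcontfun (left_translate f s) t = apply_bcontfun f (s * t)"
  by transfer simp

lemma left_translate_add:
  "left_translate (f + g) s = left_translate f s + left_translate g s"
  by (rule bcontfun_eqI) simp

lemma left_translate_scaleC:
  "left_translate (scaleC_bcontfun c f) s = scaleC_bcontfun c (left_translate f s)"
  by (rule bcontfun_eqI) simp

lemma left_translate_mult:
  "left_translate (mult_bcontfun f g) s =
    mult_bcontfun (left_translate f s) (left_translate g s)"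
  by (rule bcontfun_eqI) simp

text \<open>Associativity of \<open>G\<close> enters here: translation is a right action.\<close>

lemma left_translate_left_translate:
  "left_translate (left_translate f s) t = left_translate f (s * t)"
  by (rule bcontfun_eqI) (simp add: mult.assoc)

lemma left_translate_const: "left_translate (const_bcontfun c) s = const_bcontfun c"
  by (rule bcontfun_eqI) (simp add: const_bcontfun.rep_eq)

lemma left_arens_apply:
  "left_arens A \<phi> \<psi> f = (if f \<in> A then \<phi> (functional_act \<psi> f) else undefined)"
  by (simp add: left_arens_def)

text \<open>Dropping the condition of being nonzero from \<open>characters\<close> lets the zero
  functional be handled together with the characters.\<close>

definition multiplicative_functionals ::
    "('g::topological_space \<Rightarrow>\<^sub>C complex) set \<Rightarrow> (('g \<Rightarrow>\<^sub>C complex) \<Rightarrow> complex) set"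
  where "multiplicative_functionals A = {\<phi> \<in> extensional A.
    (\<forall>f\<in>A. \<forall>g\<in>A. \<phi> (f + g) = \<phi> f + \<phi> g) \<and>
    (\<forall>c. \<forall>f\<in>A. \<phi> (scaleC_bcontfun c f) = c * \<phi> f) \<and>
    (\<forall>f\<in>A. \<forall>g\<in>A. \<phi> (mult_bcontfun f g) = \<phi> f * \<phi> g)}"

lemma characters_eq:
  "characters A = multiplicative_functionals A - {zero_functional A}"
  by (auto simp: characters_def multiplicative_functionals_def)

lemma zero_functional_multiplicative:
  assumes "closed_subalgebra A"
  shows "zero_functional A \<in> multiplicative_functionals A"
  using assms
  by (auto simp: multiplicative_functionals_def zero_functional_def closed_subalgebra_def)

lemma characters_Un_zero:
  assumes "closed_subalgebra A"
  shows "characters A \<union> {zero_functional A} = multiplicative_functionals A"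
  using zero_functional_multiplicative[OF assms] by (auto simp: characters_eq)

context
  fixes A :: "('g::semitopological_semigroup \<Rightarrow>\<^sub>C complex) set"
  assumes subalg: "closed_subalgebra A"
    and introverted: "left_m_introverted A"
begin

lemma subalgebra_closed:
  assumes "f \<in> A" "g \<in> A"
  shows "f + g \<in> A" and "scaleC_bcontfun c f \<in> A" and "mult_bcontfun f g \<in> A"
  using subalg assms by (auto simp: closed_subalgebra_def)

lemma left_translate_closed: "f \<in> A \<Longrightarrow> left_translate f s \<in> A"
  using introverted by (simp add: left_m_introverted_def)

text \<open>Introversion speaks only of characters; the zero functional acts as 0, which lies in
  \<open>A\<close>.\<close>

lemma functional_act:
  assumes "\<phi> \<in> multiplicative_functionals A" "f \<in> A"
  shows functional_act_closed: "functional_act \<phi> f \<in> A"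
    and apply_functional_act:
      "apply_bcontfun (functional_act \<phi> f) s = \<phi> (left_translate f s)"
proof -
  have "functional_act \<phi> f \<in> A \<and>
    apply_bcontfun (functional_act \<phi> f) s = \<phi> (left_translate f s)"
  proof (cases "\<phi> = zero_functional A")
    case True
    have "0 \<in> A"
      using subalg by (simp add: closed_subalgebra_def)
    with True show ?thesis
      using assms functional_act_zero[OF introverted] left_translate_closed
      by (simp add: zero_functional_def)
  next
    case False
    then show ?thesis
      using assms functional_act_character[OF introverted] by (simp add: characters_eq)
  qed
  then show "functional_act \<phi> f \<in> A"
    and "apply_bcontfun (functional_act \<phi> f) s = \<phi> (left_translate f s)"
    by simp_all
qed

text \<open>Evaluated at a point s, each identity says that translation by s followed by \<phi>
  respects the operation.\<close>

lemma functional_act_hom: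
  assumes "\<phi> \<in> multiplicative_functionals A" "f \<in> A" "g \<in> A"
  shows "functional_act \<phi> (f + g) = functional_act \<phi> f + functional_act \<phi> g"
    and "functional_act \<phi> (scaleC_bcontfun c f) = scaleC_bcontfun c (functional_act \<phi> f)"
    and "functional_act \<phi> (mult_bcontfun f g) =
      mult_bcontfun (functional_act \<phi> f) (functional_act \<phi> g)"
  using assms
  by (auto intro!: bcontfun_eqI
      simp: apply_functional_act subalgebra_closed left_translate_closed
        left_translate_add left_translate_scaleC left_translate_mult
        multiplicative_functionals_def)

text \<open>At a point t both sides are \<phi> applied to the translate of \<open>f\<close> by
  \<open>s * t\<close>.\<close>

lemma left_translate_functional_act:
  assumes "\<phi> \<in> multiplicative_functionals A" "f \<in> A"
  shows "left_translate (functional_act \<phi> f) s = functional_act \<phi> (left_translate f s)"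
  using assms
  by (auto intro!: bcontfun_eqI
      simp: apply_functional_act left_translate_closed left_translate_left_translate)

lemma left_arens_closed:
  assumes x: "x \<in> multiplicative_functionals A" and y: "y \<in> multiplicative_functionals A"
  shows "left_arens A x y \<in> multiplicative_functionals A"
  using x functional_act_closed[OF y]
  by (auto simp: multiplicative_functionals_def left_arens_def subalgebra_closed
      functional_act_hom[OF y])

text \<open>The product acts as the composite of the two actions; this is the core of
  associativity.\<close>

lemma functional_act_left_arens:
  assumes x: "x \<in> multiplicative_functionals A" and y: "y \<in> multiplicative_functionals A"
    and f: "f \<in> A"
  shows "functional_act (left_arens A x y) f = functional_act x (functional_act y f)"
proof (rule bcontfun_eqI)
  fix s
  have "apply_bcontfun (functional_act (left_arens A x y) f) s =
      x (functional_act y (left_translate f s))"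
    using apply_functional_act[OF left_arens_closed[OF x y] f] left_translate_closed[OF f]
    by (simp add: left_arens_def)
  \<comment> \<open>The translation is pulled out of the action of \<open>y\<close>, leaving the
    action of \<open>x\<close> on \<open>functional_act y f\<close>, evaluated at
    \<open>s\<close>.\<close>
  also have "\<dots> = apply_bcontfun (functional_act x (functional_act y f)) s"
    using apply_functional_act[OF x functional_act_closed[OF y f]]
    by (simp add: left_translate_functional_act[OF y f])
  finally show "apply_bcontfun (functional_act (left_arens A x y) f) s =
      apply_bcontfun (functional_act x (functional_act y f)) s" .
qed

text \<open>Both sides send f in \<open>A\<close> to x(y.(z.f)), and both are
  \<open>undefined\<close> off \<open>A\<close>.\<close>

lemma left_arens_assoc:
  assumes "y \<in> multiplicative_functionals A" "z \<in> multiplicative_functionals A"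
  shows "left_arens A (left_arens A x y) z = left_arens A x (left_arens A y z)"
proof (rule ext)
  fix f
  show "left_arens A (left_arens A x y) z f = left_arens A x (left_arens A y z) f"
    using functional_act_left_arens[OF assms] functional_act_closed[OF assms(2)]
    by (cases "f \<in> A") (simp_all add: left_arens_apply)
qed

lemma semigroup_on_multiplicative_functionals:
  "semigroup_on (multiplicative_functionals A) (left_arens A)"
  unfolding semigroup_on_def
  using zero_functional_multiplicative[OF subalg] left_arens_closed left_arens_assoc by blast

context
  assumes unit: "const_bcontfun 1 \<in> A"
begin

text \<open>Multiplicativity gives \<phi>(f) = \<phi>(1) \<phi>(f), so a value other than 1 at the
  unit forces \<phi> to vanish on \<open>A\<close>.\<close>

lemma character_iff_unit:
  "\<phi> \<in> characters A \<longleftrightarrow> \<phi> \<in> multiplicative_functionals A \<and> \<phi> (const_bcontfun 1) = 1"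
proof -
  have "\<phi> = zero_functional A"
    if \<phi>: "\<phi> \<in> multiplicative_functionals A" and ne: "\<phi> (const_bcontfun 1) \<noteq> 1"
  proof -
    have unit_mult: "\<phi> f = \<phi> (const_bcontfun 1) * \<phi> f" if "f \<in> A" for f
    proof -
      have "mult_bcontfun (const_bcontfun 1) f = f"
        by (rule bcontfun_eqI) (simp add: const_bcontfun.rep_eq)
      then show ?thesis
        using \<phi> unit that by (fastforce simp: multiplicative_functionals_def)
    qed
    have "\<phi> f = 0" if "f \<in> A" for f
      using unit_mult[OF that] ne by simp
    then show ?thesis
      using \<phi> by (auto simp: multiplicative_functionals_def zero_functional_def
          extensional_def fun_eq_iff)
  qed
  moreover have "zero_functional A (const_bcontfun 1) = 0"
    using unit by (simp add: zero_functional_def)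
  ultimately show ?thesis
    by (auto simp: characters_eq)
qed

text \<open>Point evaluations witness that the set of characters is nonempty.\<close>

lemma evaluation_character: "(\<lambda>f\<in>A. apply_bcontfun f t) \<in> characters A"
  unfolding character_iff_unit
  using unit by (auto simp: multiplicative_functionals_def subalgebra_closed
      const_bcontfun.rep_eq)

text \<open>Constants are translation invariant and y(1) = 1, so y.1 = 1 and the product takes the
  value x(1) = 1 at the unit.\<close>

lemma left_arens_character:
  assumes "x \<in> characters A" "y \<in> characters A"
  shows "left_arens A x y \<in> characters A"
proof -
  have "functional_act y (const_bcontfun 1) = const_bcontfun 1"
    using assms(2) unit
    by (auto intro!: bcontfun_eqI simp: character_iff_unit apply_functional_act
        left_translate_const const_bcontfun.rep_eq)
  then show ?thesis
    using assms unit left_arens_closed by (simp add: character_iff_unit left_arens_def)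
qed

lemma semigroup_on_characters: "semigroup_on (characters A) (left_arens A)"
  unfolding semigroup_on_def
  \<comment> \<open>Associativity is inherited, since characters are multiplicative
    functionals.\<close>
  using evaluation_character left_arens_character left_arens_assoc
  by (metis Diff_iff characters_eq empty_iff)

end

end

theorem proposition2p8:
  fixes A :: "('g::semitopological_semigroup \<Rightarrow>\<^sub>C complex) set"
  assumes "closed_subalgebra A"
    and "left_m_introverted A"
  shows "semigroup_on (characters A \<union> {zero_functional A}) (left_arens A) \<and>
    (const_bcontfun 1 \<in> A \<longrightarrow> semigroup_on (characters A) (left_arens A))"
  using semigroup_on_multiplicative_functionals[OF assms] semigroup_on_characters[OF assms]
  unfolding characters_Un_zero[OF assms(1)] by blast

end
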